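(* Let $k$ be a positive integer and let $G=(V,E)$ be a critically $k$-biconnected bipartite graph. Then $\tau(G)\ge \frac{|V|}{2k^2}$.
   Context: A bipartite graph $G=(V,E)$ with bipartition $(A,B)$ is $k$-biconnected if $|A|,|B|\ge k$ and for every $W\subseteq V$ with $|W\cap A|\le k-1$ and $|W\cap B|\le k-1$ the graph $G-W$ is connected. $G$ is critically $k$-biconnected if it is $k$-biconnected but $G-v$ is not $k$-biconnected for every $v\in V$. A vertex cover of $G$ is a set of vertices meeting every edge; $\tau(G)$ is the minimum size of a vertex cover. *)

theory Defs
  imports Complex_Main "Graph_Theory.Digraph_Component"
begin

text \<open>
  The locale predicate \<^term>\<open>graph\<close> describes the finite simple undirected graphs: finite
  digraphs without loops and parallel arcs in which every arc has its reverse, an edge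
  being a pair of mutually reverse arcs.  Deleting a vertex set \<^term>\<open>W\<close> from \<^term>\<open>G\<close> is
  passing to the induced subgraph on \<^term>\<open>verts G - W\<close>.
\<close>

definition bipartite_graph :: "('a, 'b) pre_digraph \<Rightarrow> 'a set \<Rightarrow> 'a set \<Rightarrow> bool" where
  "bipartite_graph G A B \<longleftrightarrow>
     graph G \<and> verts G = A \<union> B \<and> A \<inter> B = {} \<and>
     (\<forall>e\<in>arcs G. (tail G e \<in> A \<and> head G e \<in> B) \<or> (tail G e \<in> B \<and> head G e \<in> A))"

text \<open>
  Intended for \<^term>\<open>bipartite_graph G A B\<close> and \<open>k \<ge> 1\<close>, so that \<open>k - 1\<close> does not truncate.
\<close>

definition biconnected :: "nat \<Rightarrow> ('a, 'b) pre_digraph \<Rightarrow> 'a set \<Rightarrow> 'a set \<Rightarrow> bool" where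
  "biconnected k G A B \<longleftrightarrow>
     card A \<ge> k \<and> card B \<ge> k \<and>
     (\<forall>W \<subseteq> verts G. card (W \<inter> A) \<le> k - 1 \<and> card (W \<inter> B) \<le> k - 1 \<longrightarrow>
        Digraph_Component.connected (G \<restriction> (verts G - W)))"

text \<open>The graph \<open>G - v\<close> carries the bipartition inherited from \<^term>\<open>G\<close>.\<close>

definition critically_biconnected ::
    "nat \<Rightarrow> ('a, 'b) pre_digraph \<Rightarrow> 'a set \<Rightarrow> 'a set \<Rightarrow> bool" where
  "critically_biconnected k G A B \<longleftrightarrow>
     biconnected k G A B \<and>
     (\<forall>v\<in>verts G. \<not> biconnected k (G \<restriction> (verts G - {v})) (A - {v}) (B - {v}))"

definition vertex_cover :: "('a, 'b) pre_digraph \<Rightarrow> 'a set \<Rightarrow> bool" where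
  "vertex_cover G C \<longleftrightarrow>
     C \<subseteq> verts G \<and> (\<forall>e\<in>arcs G. tail G e \<in> C \<or> head G e \<in> C)"

definition vertex_cover_number :: "('a, 'b) pre_digraph \<Rightarrow> nat" where
  "vertex_cover_number G = Min (card ` {C. vertex_cover G C})"

end

theory Submission
  imports Defs
begin

text \<open>
  Let \<open>C\<close> be a vertex cover.  A vertex \<open>v \<in> A - C\<close> has all its (at least \<open>k\<close>) neighbours in
  \<open>B \<inter> C\<close> and is viewed as a hyperedge on that set.  Criticality puts \<open>v\<close> into a separator with
  at most \<open>k\<close> vertices in \<open>A\<close> and at most \<open>k - 1\<close> in \<open>B\<close> that splits the neighbourhood of \<open>v\<close>.
  Such a separator destroys at most \<open>k\<close> hyperedges, and each other hyperedge lies in one of two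
  proper parts of the ground set that overlap in at most \<open>k - 1\<close> points.  Recursion on the parts
  shows that there are at most \<open>k\<^sup>2 |B \<inter> C|\<close> hyperedges.  By symmetry
  \<open>|V| \<le> (k\<^sup>2 + 1) |C| \<le> 2 k\<^sup>2 |C|\<close>.
\<close>

section \<open>Counting hyperedges by recursive splitting\<close>

text \<open>The bound is shaped for the recursion. If both parts have size at least
  \<open>k\<close>, then \<open>y + z \<le> card X + (k - 1)\<close> gives
  \<open>(y + 1 - k) + (z + 1 - k) \<le> card X + 1 - k\<close>, so the right-hand sides for the
  parts add up to at most that for \<open>X\<close>. The summand \<open>k\<close> on the left occurs
  twice among the parts and only once for \<open>X\<close>; the spare copy pays for the hyperedges
  lost to \<open>D\<close>.\<close>

lemma card_hyperedges_le:
  fixes N :: "'a \<Rightarrow> 'b set"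
  assumes k: "k \<ge> 1" and fI: "finite I"
    and deg: "\<And>v. v \<in> I \<Longrightarrow> k \<le> card (N v)"
    and split: "\<And>v. v \<in> I \<Longrightarrow> \<exists>D Y Z. finite D \<and> card D \<le> k \<and> finite (Y \<inter> Z) \<and> card (Y \<inter> Z) \<le> k - 1 \<and>
      N v \<subseteq> Y \<union> Z \<and> \<not> N v \<subseteq> Y \<and> \<not> N v \<subseteq> Z \<and> (\<forall>u\<in>I - D. N u \<subseteq> Y \<or> N u \<subseteq> Z)"
    and "finite X" "k \<le> card X"
  shows "card {v \<in> I. N v \<subseteq> X} + k \<le> k\<^sup>2 * (card X + 1 - k)"
  using \<open>finite X\<close> \<open>k \<le> card X\<close>
proof (induction "card X" arbitrary: X rule: less_induct)
  case less
  let ?I = "\<lambda>X. {v \<in> I. N v \<subseteq> X}"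
  have kk: "k \<le> k\<^sup>2"
    by (simp add: power2_eq_square)
  show ?case
  proof (cases "?I X = {}")
    case True
    have "k\<^sup>2 * 1 \<le> k\<^sup>2 * (card X + 1 - k)"
      using less.prems(2) by (intro mult_le_mono2) linarith
    with True kk show ?thesis
      by (simp only: card.empty)
  next
    case False
    then obtain v where v: "v \<in> I" "N v \<subseteq> X" by auto
    from split[OF v(1)] obtain D Y Z where D: "finite D" "card D \<le> k"
      and YZ: "finite (Y \<inter> Z)" "card (Y \<inter> Z) \<le> k - 1"
      and vYZ: "N v \<subseteq> Y \<union> Z" "\<not> N v \<subseteq> Y" "\<not> N v \<subseteq> Z"
      and parts: "\<And>u. u \<in> I - D \<Longrightarrow> N u \<subseteq> Y \<or> N u \<subseteq> Z"
      by metis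
    define y z where "y = card (X \<inter> Y)" and "z = card (X \<inter> Z)"
    \<comment> \<open>The hyperedge \<open>N v\<close> lies inside \<open>X\<close> but in neither
      \<open>Y\<close> nor \<open>Z\<close>, so both traces on \<open>X\<close> are proper and the
      induction applies to them.\<close>
    have "y < card X" "z < card X"
      unfolding y_def z_def using v(2) vYZ less.prems(1) by (auto intro!: psubset_card_mono)
    have "y + z = card (X \<inter> Y \<union> X \<inter> Z) + card (X \<inter> (Y \<inter> Z))"
      unfolding y_def z_def using less.prems(1) card_Un_Int[of "X \<inter> Y" "X \<inter> Z"]
      by (simp add: Int_ac)
    also have "card (X \<inter> Y \<union> X \<inter> Z) \<le> card X"
      using less.prems(1) by (intro card_mono) auto
    also have "card (X \<inter> (Y \<inter> Z)) \<le> card (Y \<inter> Z)"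
      using YZ(1) by (intro card_mono) auto
    finally have yz: "y + z \<le> card X + (k - 1)"
      using YZ(2) by linarith
    have fin: "finite (?I W)" for W
      using fI by simp
    have "?I X \<subseteq> D \<union> (?I (X \<inter> Y) \<union> ?I (X \<inter> Z))"
      using parts by blast
    then have "card (?I X) \<le> card (D \<union> (?I (X \<inter> Y) \<union> ?I (X \<inter> Z)))"
      using D(1) fin by (intro card_mono finite_UnI)
    also have "\<dots> \<le> card D + (card (?I (X \<inter> Y)) + card (?I (X \<inter> Z)))"
      by (meson card_Un_le add_left_mono order_trans)
    finally have cI: "card (?I X) \<le> k + card (?I (X \<inter> Y)) + card (?I (X \<inter> Z))"
      using D(2) by linarith
    have IH: "card (?I (X \<inter> W)) + k \<le> k\<^sup>2 * (card (X \<inter> W) + 1 - k)"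
      if "card (X \<inter> W) < card X" "k \<le> card (X \<inter> W)" for W
      using less.hyps[of "X \<inter> W"] that less.prems(1) by simp
    have small: "card (?I (X \<inter> W)) = 0" if "card (X \<inter> W) < k" for W
    proof -
      have "?I (X \<inter> W) = {}"
        using deg that less.prems(1) by (metis (no_types, lifting) Collect_empty_eq card_mono finite_Int leD le_less_trans)
      then show ?thesis by (simp only: card.empty)
    qed
    \<comment> \<open>Case where only one part can hold hyperedges: that part is smaller than
      \<open>X\<close> by at least one point, which frees \<open>k\<^sup>2 \<ge> k\<close> on the
      right, enough for the loss to \<open>D\<close>.\<close>
    have one: "card (?I X) + k \<le> k\<^sup>2 * (card X + 1 - k)"
      if "card (?I X) \<le> k + a" "a + k \<le> k\<^sup>2 * (w + 1 - k)" "w < card X" "k \<le> w" for a w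
    proof -
      have "card (?I X) + k \<le> k\<^sup>2 + k\<^sup>2 * (w + 1 - k)"
        using that kk by linarith
      also have "\<dots> = k\<^sup>2 * Suc (w + 1 - k)"
        by simp
      also have "\<dots> \<le> k\<^sup>2 * (card X + 1 - k)"
        using that(3,4) by (intro mult_le_mono2) linarith
      finally show ?thesis .
    qed
    consider "k \<le> y" "k \<le> z" | "k \<le> y" "z < k" | "y < k" "k \<le> z" | "y < k" "z < k"
      by linarith
    then show ?thesis
    proof cases
      case 1
      have "card (?I X) + k \<le> (card (?I (X \<inter> Y)) + k) + (card (?I (X \<inter> Z)) + k)"
        using cI by linarith
      also have "\<dots> \<le> k\<^sup>2 * (y + 1 - k) + k\<^sup>2 * (z + 1 - k)"
        using IH 1 \<open>y < card X\<close> \<open>z < card X\<close> unfolding y_def z_def by (intro add_mono) auto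
      also have "\<dots> = k\<^sup>2 * ((y + 1 - k) + (z + 1 - k))"
        by (simp add: distrib_left)
      also have "\<dots> \<le> k\<^sup>2 * (card X + 1 - k)"
        using yz 1 k by (intro mult_le_mono2) linarith
      finally show ?thesis .
    next
      case 2
      with cI small[of Z] IH[of Y] \<open>y < card X\<close> show ?thesis
        unfolding y_def z_def by (intro one[of "card (?I (X \<inter> Y))" "card (X \<inter> Y)"]) auto
    next
      case 3
      with cI small[of Y] IH[of Z] \<open>z < card X\<close> show ?thesis
        unfolding y_def z_def by (intro one[of "card (?I (X \<inter> Z))" "card (X \<inter> Z)"]) auto
    next
      case 4
      \<comment> \<open>Neither part holds a hyperedge, so at most \<open>k\<close> remain and
        \<open>2 * k \<le> k\<^sup>2\<close> suffices. This inequality fails for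
        \<open>k = 1\<close>, but then both traces are empty and \<open>N v\<close> would be empty
        too.\<close>
      have "k \<noteq> 1"
      proof
        assume "k = 1"
        with 4 have "X \<inter> Y = {}" "X \<inter> Z = {}"
          using less.prems(1) by (simp_all add: y_def z_def)
        with v vYZ have "N v = {}" by blast
        with deg[OF v(1)] \<open>k = 1\<close> show False by simp
      qed
      with k have "2 * k \<le> k\<^sup>2"
        by (simp add: power2_eq_square)
      also have "k\<^sup>2 * 1 \<le> k\<^sup>2 * (card X + 1 - k)"
        using less.prems(2) by (intro mult_le_mono2) linarith
      finally show ?thesis
        using cI small[of Y] small[of Z] 4 unfolding y_def z_def by linarith
    qed
  qed
qed

section \<open>Connectivity through closed vertex sets\<close>

lemma symcl_arcs_ends_induce_subgraph:
  "(x, y) \<in> (arcs_ends (G \<restriction> U))\<^sup>s \<longleftrightarrow> x \<in> U \<and> y \<in> U \<and> (x, y) \<in> (arcs_ends G)\<^sup>s"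
  by (auto simp: symcl_def arcs_ends_def arc_to_ends_def)

text \<open>A closed set containing the start of a walk contains all of it; conversely, the set
  reachable from a vertex is closed. Adjacency is taken in \<open>G\<close> rather than in the
  induced subgraph, so that different sets \<open>U\<close> can be compared directly.\<close>

lemma connected_induce_subgraph_iff:
  "Digraph_Component.connected (G \<restriction> U) \<longleftrightarrow> U \<noteq> {} \<and>
     (\<forall>P\<subseteq>U. P \<noteq> {} \<longrightarrow> (\<forall>x\<in>P. \<forall>y\<in>U. (x, y) \<in> (arcs_ends G)\<^sup>s \<longrightarrow> y \<in> P) \<longrightarrow> P = U)"
  (is "?L \<longleftrightarrow> ?R")
proof
  let ?E = "(arcs_ends (G \<restriction> U))\<^sup>s"
  assume ?L
  then have ne: "U \<noteq> {}" and reach: "\<And>u v. u \<in> U \<Longrightarrow> v \<in> U \<Longrightarrow> (u, v) \<in> rtrancl_on U ?E"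
    by (auto simp: connected_conv)
  have "P = U" if P: "P \<subseteq> U" "P \<noteq> {}"
    and closed: "\<forall>x\<in>P. \<forall>y\<in>U. (x, y) \<in> (arcs_ends G)\<^sup>s \<longrightarrow> y \<in> P" for P
  proof -
    from P obtain u where u: "u \<in> P" by auto
    have "v \<in> P" if "v \<in> U" for v
    proof -
      have "(u, v) \<in> rtrancl_on U ?E" using reach u P(1) that by auto
      then show "v \<in> P"
        by (induction rule: rtrancl_on_induct)
           (use u closed in \<open>auto simp: symcl_arcs_ends_induce_subgraph\<close>)
    qed
    with P(1) show ?thesis by auto
  qed
  with ne show ?R by blast
next
  let ?E = "(arcs_ends (G \<restriction> U))\<^sup>s"
  assume R: ?R
  have "(u, v) \<in> rtrancl_on U ?E" if "u \<in> U" "v \<in> U" for u v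
  proof -
    let ?P = "{w \<in> U. (u, w) \<in> rtrancl_on U ?E}"
    have "u \<in> ?P" using that by auto
    moreover have "y \<in> ?P" if "x \<in> ?P" "y \<in> U" "(x, y) \<in> (arcs_ends G)\<^sup>s" for x y
      using that by (auto simp: symcl_arcs_ends_induce_subgraph intro: rtrancl_on_into_rtrancl_on)
    ultimately have "?P = U"
      using R by blast
    with that show ?thesis by blast
  qed
  with R show ?L by (simp add: connected_conv)
qed

section \<open>Neighbourhoods and minimum degree\<close>

definition nbhd :: "('a, 'b) pre_digraph \<Rightarrow> 'a \<Rightarrow> 'a set" where
  "nbhd G v = {u. (v, u) \<in> (arcs_ends G)\<^sup>s}"

lemma nbhd_iff:
  "u \<in> nbhd G v \<longleftrightarrow>
    (\<exists>e\<in>arcs G. tail G e = v \<and> head G e = u \<or> tail G e = u \<and> head G e = v)"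
  by (auto simp: nbhd_def symcl_def arcs_ends_def arc_to_ends_def)

lemma nbhd_sym: "u \<in> nbhd G v \<longleftrightarrow> v \<in> nbhd G u"
  by (auto simp: nbhd_def symcl_def)

lemma bipartite_graph_commute: "bipartite_graph G A B \<Longrightarrow> bipartite_graph G B A"
  by (auto simp: bipartite_graph_def)

lemma biconnected_commute: "biconnected k G A B \<Longrightarrow> biconnected k G B A"
  by (auto simp: biconnected_def)

lemma critically_biconnected_commute:
  "critically_biconnected k G A B \<Longrightarrow> critically_biconnected k G B A"
  using biconnected_commute unfolding critically_biconnected_def by blast

lemma finite_bipartite_graph:
  assumes "bipartite_graph G A B"
  shows "finite A" "finite B"
proof -
  interpret graph G using assms by (simp add: bipartite_graph_def)
  show "finite A" "finite B"
    using assms finite_verts unfolding bipartite_graph_def by auto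
qed

lemma nbhd_subset:
  assumes "bipartite_graph G A B" "v \<in> A"
  shows "nbhd G v \<subseteq> B"
proof
  fix u assume "u \<in> nbhd G v"
  then obtain e where e: "e \<in> arcs G" "tail G e = v \<and> head G e = u \<or> tail G e = u \<and> head G e = v"
    unfolding nbhd_iff by blast
  then have "(tail G e \<in> A \<and> head G e \<in> B) \<or> (tail G e \<in> B \<and> head G e \<in> A)" "A \<inter> B = {}"
    using assms(1) unfolding bipartite_graph_def by blast+
  with e(2) assms(2) show "u \<in> B" by blast
qed

lemma nbhd_subset_cover:
  assumes "vertex_cover G C" "v \<notin> C"
  shows "nbhd G v \<subseteq> C"
proof
  fix u assume "u \<in> nbhd G v"
  then obtain e where e: "e \<in> arcs G" "tail G e = v \<and> head G e = u \<or> tail G e = u \<and> head G e = v"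
    unfolding nbhd_iff by blast
  from assms(1) e(1) have "tail G e \<in> C \<or> head G e \<in> C"
    by (simp add: vertex_cover_def)
  with e(2) assms(2) show "u \<in> C" by metis
qed

text \<open>Fewer than \<open>k\<close> neighbours could all be deleted without disconnecting
  \<open>G\<close>. But \<open>v\<close> is then isolated, hence the only vertex left, so its
  neighbourhood is all of \<open>B\<close>, which has at least \<open>k\<close> elements.\<close>

lemma le_card_nbhd:
  assumes k: "k \<ge> 1" and bip: "bipartite_graph G A B" and bic: "biconnected k G A B" and v: "v \<in> A"
  shows "k \<le> card (nbhd G v)"
proof (rule ccontr)
  assume small: "\<not> k \<le> card (nbhd G v)"
  let ?U = "verts G - nbhd G v"
  have sub: "nbhd G v \<subseteq> B" and V: "verts G = A \<union> B" "A \<inter> B = {}"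
    using nbhd_subset[OF bip v] bip by (auto simp: bipartite_graph_def)
  from sub V(2) have "nbhd G v \<inter> A = {}" "nbhd G v \<inter> B = nbhd G v" by auto
  moreover have "nbhd G v \<subseteq> verts G" using sub V(1) by blast
  ultimately have "Digraph_Component.connected (G \<restriction> ?U)"
    using bic small unfolding biconnected_def by simp
  moreover have "{v} \<subseteq> ?U" "\<forall>x\<in>{v}. \<forall>y\<in>?U. (x, y) \<in> (arcs_ends G)\<^sup>s \<longrightarrow> y \<in> {v}"
    using v V sub by (auto simp: nbhd_def)
  ultimately have "{v} = ?U"
    unfolding connected_induce_subgraph_iff by simp
  then have "verts G \<subseteq> insert v (nbhd G v)" by auto
  with V v have "B \<subseteq> nbhd G v" by auto
  then have "nbhd G v = B" using sub by auto
  with small bic show False by (simp add: biconnected_def)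
qed

section \<open>Separators from criticality\<close>

text \<open>By \<open>k < card A\<close>, both classes of \<open>G - v\<close> still have at least
  \<open>k\<close> vertices, so biconnectivity can only fail through a separator \<open>W\<close> of
  \<open>G - v\<close>. As \<open>G - W\<close> is connected, \<open>v\<close> must have neighbours
  on both sides of the split.\<close>

lemma critical_vertex_separator:
  assumes k: "k \<ge> 1" and bip: "bipartite_graph G A B" and crit: "critically_biconnected k G A B"
    and v: "v \<in> A" and large: "k < card A"
  shows "\<exists>D Y Z. finite D \<and> card D \<le> k \<and> finite (Y \<inter> Z) \<and> card (Y \<inter> Z) \<le> k - 1 \<and>
      nbhd G v \<subseteq> Y \<union> Z \<and> \<not> nbhd G v \<subseteq> Y \<and> \<not> nbhd G v \<subseteq> Z \<and>
      (\<forall>u\<in>A - D. nbhd G u \<subseteq> Y \<or> nbhd G u \<subseteq> Z)"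
proof -
  have V: "verts G = A \<union> B" "A \<inter> B = {}" and fin: "finite A" "finite B"
    using bip finite_bipartite_graph[OF bip] by (auto simp: bipartite_graph_def)
  have bic: "biconnected k G A B"
    using crit by (simp add: critically_biconnected_def)
  let ?G = "G \<restriction> (verts G - {v})"
  have vB: "B - {v} = B" using v V by auto
  have "\<not> biconnected k ?G (A - {v}) B"
    using crit v V(1) vB unfolding critically_biconnected_def by (metis UnCI)
  moreover have cA: "k \<le> card (A - {v})" and "k \<le> card B"
    using large v fin bic by (auto simp: biconnected_def)
  ultimately obtain W where W: "W \<subseteq> verts G - {v}" "card (W \<inter> (A - {v})) \<le> k - 1"
      "card (W \<inter> B) \<le> k - 1"
    and ncon: "\<not> Digraph_Component.connected (?G \<restriction> (verts G - {v} - W))"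
    unfolding biconnected_def by auto
  let ?U = "verts G - {v} - W"
  have WA: "W \<inter> (A - {v}) = W \<inter> A" using W(1) by auto
  have "?G \<restriction> ?U = G \<restriction> ?U"
    by (auto simp: induce_subgraph_def)
  with ncon have ncon: "\<not> Digraph_Component.connected (G \<restriction> ?U)" by simp
  \<comment> \<open>The empty graph also counts as not connected; excluding it guarantees a genuine
    split into two nonempty sides.\<close>
  have "?U \<noteq> {}"
  proof
    assume "?U = {}"
    then have "A - {v} \<subseteq> W \<inter> (A - {v})" using V by auto
    then have "k \<le> card (W \<inter> (A - {v}))"
      using cA fin by (meson card_mono finite_Diff finite_Int order_trans)
    with W(2) k show False by linarith
  qed
  with ncon obtain P where P: "P \<subseteq> ?U" "P \<noteq> {}" "P \<noteq> ?U"
    and closed: "\<And>x y. x \<in> P \<Longrightarrow> y \<in> ?U \<Longrightarrow> y \<in> nbhd G x \<Longrightarrow> y \<in> P"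
    unfolding connected_induce_subgraph_iff nbhd_def by blast
  define Q where "Q = ?U - P"
  have closedQ: "y \<in> Q" if "x \<in> Q" "y \<in> ?U" "y \<in> nbhd G x" for x y
    using closed[of y x] that nbhd_sym[of x G y] P(1) by (auto simp: Q_def)
  have con: "Digraph_Component.connected (G \<restriction> (verts G - W))"
    using bic W WA unfolding biconnected_def by auto
  \<comment> \<open>If all surviving neighbours of \<open>v\<close> lay in one closed side
    \<open>R\<close>, then \<open>insert v R\<close> would be closed in the connected graph
    \<open>G - W\<close> and hence everything. Applied to \<open>P\<close> and to \<open>Q\<close>,
    this leaves the other side empty.\<close>
  have all: "insert v R = verts G - W"
    if "R \<subseteq> ?U" "nbhd G v \<subseteq> R \<union> W"
      "\<And>x y. x \<in> R \<Longrightarrow> y \<in> ?U \<Longrightarrow> y \<in> nbhd G x \<Longrightarrow> y \<in> R" for R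
  proof -
    have "insert v R \<subseteq> verts G - W" using that(1) v V W(1) by auto
    moreover have "\<forall>x\<in>insert v R. \<forall>y\<in>verts G - W. (x, y) \<in> (arcs_ends G)\<^sup>s \<longrightarrow> y \<in> insert v R"
      using that unfolding nbhd_def by blast
    ultimately show ?thesis
      using con unfolding connected_induce_subgraph_iff by blast
  qed
  \<comment> \<open>\<open>v\<close> belongs to neither side and so joins \<open>D\<close>, raising
    its size bound from \<open>k - 1\<close> to \<open>k\<close>. The deleted vertices of
    \<open>B\<close> go to both sides and form exactly their overlap.\<close>
  let ?D = "insert v (W \<inter> A)" and ?Y = "P \<union> W \<inter> B" and ?Z = "Q \<union> W \<inter> B"
  have "?Y \<inter> ?Z = W \<inter> B" by (auto simp: Q_def)
  moreover have "card ?D \<le> k"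
    using W(2) WA k card_insert_le_m1[of k "W \<inter> A" v] by simp
  moreover have UPQ: "B - W \<subseteq> P \<union> Q"
    using V v by (auto simp: Q_def)
  then have "nbhd G v \<subseteq> ?Y \<union> ?Z"
    using nbhd_subset[OF bip v] by blast
  moreover have "\<not> nbhd G v \<subseteq> ?Y"
    using all[of P] closed P by blast
  moreover have "\<not> nbhd G v \<subseteq> ?Z"
  proof
    assume "nbhd G v \<subseteq> ?Z"
    then have "insert v Q = verts G - W"
      using all[of Q] closedQ by (auto simp: Q_def)
    then show False using P(1,2) unfolding Q_def by blast
  qed
  \<comment> \<open>Such a \<open>u\<close> survives on one side; its surviving neighbours stay
    there by closedness, and its deleted ones lie in \<open>W \<inter> B\<close>.\<close>
  moreover have "nbhd G u \<subseteq> ?Y \<or> nbhd G u \<subseteq> ?Z" if "u \<in> A - ?D" for u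
  proof -
    have uB: "nbhd G u \<subseteq> B" using nbhd_subset[OF bip] that by auto
    then have "y \<in> ?U" if "y \<in> nbhd G u" "y \<notin> W" for y
      using that V v by auto
    moreover have "u \<in> P \<or> u \<in> Q" using that V by (auto simp: Q_def)
    ultimately show ?thesis using closed closedQ uB by blast
  qed
  ultimately show ?thesis
    using fin W(3) by (intro conjI ballI exI[where x="?D"] exI[where x="?Y"] exI[where x="?Z"]) simp_all
qed

section \<open>Vertices outside a cover, and the final count\<close>

text \<open>The hyperedges are the neighbourhoods of the vertices in \<open>A - C\<close>, on the
  ground set \<open>B \<inter> C\<close>. A single vertex outside \<open>C\<close> already forces
  \<open>k \<le> card (B \<inter> C)\<close>, which starts the recursion and also settles the case
  \<open>card A \<le> k\<close>, where no separator is available.\<close>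

lemma card_outside_cover_le:
  assumes k: "k \<ge> 1" and bip: "bipartite_graph G A B" and crit: "critically_biconnected k G A B"
    and cov: "vertex_cover G C"
  shows "card (A - C) \<le> k\<^sup>2 * card (B \<inter> C)"
proof (cases "A - C = {}")
  case True
  then show ?thesis by (simp only: card.empty)
next
  case False
  have fin: "finite A" "finite B"
    using finite_bipartite_graph[OF bip] .
  have bic: "biconnected k G A B"
    using crit by (simp add: critically_biconnected_def)
  have sub: "nbhd G v \<subseteq> B \<inter> C" if "v \<in> A - C" for v
    using nbhd_subset[OF bip] nbhd_subset_cover[OF cov] that by blast
  have deg: "k \<le> card (nbhd G v)" if "v \<in> A - C" for v
    using le_card_nbhd[OF k bip bic] that by blast
  from False obtain v where v: "v \<in> A - C" by blast
  have "card (nbhd G v) \<le> card (B \<inter> C)"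
    using sub[OF v] fin by (intro card_mono) auto
  with deg[OF v] have kBC: "k \<le> card (B \<inter> C)" by linarith
  show ?thesis
  proof (cases "k < card A")
    case True
    have "card {v \<in> A - C. nbhd G v \<subseteq> B \<inter> C} + k \<le> k\<^sup>2 * (card (B \<inter> C) + 1 - k)"
    proof (rule card_hyperedges_le[OF k _ deg])
      fix v assume "v \<in> A - C"
      then show "\<exists>D Y Z. finite D \<and> card D \<le> k \<and> finite (Y \<inter> Z) \<and> card (Y \<inter> Z) \<le> k - 1 \<and>
        nbhd G v \<subseteq> Y \<union> Z \<and> \<not> nbhd G v \<subseteq> Y \<and> \<not> nbhd G v \<subseteq> Z \<and>
        (\<forall>u\<in>A - C - D. nbhd G u \<subseteq> Y \<or> nbhd G u \<subseteq> Z)"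
        using critical_vertex_separator[OF k bip crit _ True, of v] by blast
    qed (use fin kBC in auto)
    also have "{v \<in> A - C. nbhd G v \<subseteq> B \<inter> C} = A - C"
      using sub by blast
    also have "k\<^sup>2 * (card (B \<inter> C) + 1 - k) \<le> k\<^sup>2 * card (B \<inter> C)"
      using k by (intro mult_le_mono2) linarith
    finally show ?thesis by linarith
  next
    case False
    have "card (A - C) \<le> card A"
      using fin by (intro card_mono) auto
    also have "\<dots> \<le> card (B \<inter> C)"
      using False kBC by linarith
    also have "\<dots> \<le> k\<^sup>2 * card (B \<inter> C)"
      using k by simp
    finally show ?thesis .
  qed
qed

theorem theorem5p1:
  fixes G :: "('a, 'b) pre_digraph" and A B :: "'a set" and k :: nat
  assumes "k \<ge> 1"
    and "bipartite_graph G A B"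
    and "critically_biconnected k G A B"
  shows "real (vertex_cover_number G) \<ge> real (card (verts G)) / (2 * (real k)\<^sup>2)"
proof -
  interpret graph G using assms(2) by (simp add: bipartite_graph_def)
  have V: "verts G = A \<union> B" "A \<inter> B = {}" and fin: "finite A" "finite B"
    using assms(2) finite_bipartite_graph[OF assms(2)] by (auto simp: bipartite_graph_def)
  \<comment> \<open>The covers form a finite nonempty family, so the \<open>Min\<close> in the cover
    number is attained by an actual cover.\<close>
  have "{C. vertex_cover G C} \<subseteq> Pow (verts G)" "vertex_cover G (verts G)"
    by (auto simp: vertex_cover_def)
  then have "finite {C. vertex_cover G C}" "{C. vertex_cover G C} \<noteq> {}"
    using finite_verts by (auto simp: finite_subset)
  then have "vertex_cover_number G \<in> card ` {C. vertex_cover G C}"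
    unfolding vertex_cover_number_def by (intro Min_in) simp_all
  then obtain C where C: "vertex_cover G C" "vertex_cover_number G = card C" by auto
  have split: "card S = card (S \<inter> C) + card (S - C)" if "finite S" for S
    using that by (metis card_Int_Diff)
  have "C = (A \<inter> C) \<union> (B \<inter> C)"
    using C(1) V by (auto simp: vertex_cover_def)
  then have cC: "card C = card (A \<inter> C) + card (B \<inter> C)"
    using V(2) fin card_Un_disjoint[of "A \<inter> C" "B \<inter> C"] by (simp add: disjoint_iff)
  have "card (verts G) = card A + card B"
    using V fin by (simp add: card_Un_disjoint)
  also have "\<dots> = card C + card (A - C) + card (B - C)"
    using split[OF fin(1)] split[OF fin(2)] cC by linarith
  \<comment> \<open>The two classes are treated symmetrically: \<open>A - C\<close> is charged to
    \<open>B \<inter> C\<close>, and \<open>B - C\<close> to \<open>A \<inter> C\<close>.\<close>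
  also have "\<dots> \<le> card C + k\<^sup>2 * card (B \<inter> C) + k\<^sup>2 * card (A \<inter> C)"
    using card_outside_cover_le[OF assms C(1)]
      card_outside_cover_le[OF assms(1) bipartite_graph_commute[OF assms(2)]
        critically_biconnected_commute[OF assms(3)] C(1)] by linarith
  also have "\<dots> = card C + k\<^sup>2 * card C"
    by (simp add: cC algebra_simps)
  \<comment> \<open>The factor 2 arises from \<open>1 \<le> k\<^sup>2\<close>, applied to the
    vertices of the cover itself.\<close>
  also have "\<dots> \<le> k\<^sup>2 * card C + k\<^sup>2 * card C"
    using assms(1) by simp
  finally have "card (verts G) \<le> 2 * k\<^sup>2 * card C" by simp
  then have "real (card (verts G)) \<le> real (2 * k\<^sup>2 * card C)"
    by (simp only: of_nat_le_iff)
  with C(2) assms(1) show ?thesis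
    by (simp add: field_simps)
qed

end
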